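(* Let $N\ge3$, $\ell\ge2$, $1<p<2$, let $\Omega\subset\mathbb{R}^N$ be a nonempty open set, let $H$ be either $H_0^1(\Omega)$ or $D_0^{1,2}(\Omega)$, and let $\lambda\in\mathbb{R}$ be such that $-\Delta+\lambda$ is well defined and coercive in $H$. Let $(\beta_{ij})$ be a real symmetric $\ell\times\ell$ matrix with $\beta_{ii}>0$ and $\beta_{ij}\ge0$ for all $i,j=1,\dots,\ell$, $i\ne j$. Then for each $i=1,\dots,\ell$ there exists $c_i>0$ such that $(c_1u,\dots,c_\ell u)$ is a solution to the system $$-\Delta u_i+\lambda u_i=\sum_{j=1}^\ell\beta_{ij}|u_j|^p|u_i|^{p-2}u_i,\qquad u_i\in H,\quad i=1,\dots,\ell,$$ for every solution $u$ to the equation $$-\Delta u+\lambda u=|u|^{2p-2}u,\qquad u\in H.$$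
   Context: $D_0^{1,2}(\Omega)$ is the completion of $C_c^\infty(\Omega)$ with respect to the norm $(\int_\Omega|\nabla u|^2)^{1/2}$. Solutions are understood in the weak sense, and $|t|^{p-2}t:=0$ for $t=0$. "$-\Delta+\lambda$ is well defined and coercive in $H$" means that $\big(\int_\Omega(|\nabla v|^2+\lambda v^2)\big)^{1/2}$ is a well-defined norm in $H$, equivalent to the standard one. *)

theory Defs
  imports "HOL-Analysis.Analysis"
begin

text \<open>
  Functions on an open set \<open>\<Omega>\<close> are represented by total functions whose values outside \<open>\<Omega>\<close>
  play no role; elements of function spaces are representatives of classes modulo equality
  almost everywhere on \<open>\<Omega>\<close>.
\<close>

definition grad :: "('a::euclidean_space \<Rightarrow> real) \<Rightarrow> 'a \<Rightarrow> 'a" where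
  "grad f x = (THE D. GDERIV f x :> D)"

primrec Ck :: "nat \<Rightarrow> ('a::euclidean_space \<Rightarrow> real) \<Rightarrow> bool" where
  "Ck 0 f \<longleftrightarrow> continuous_on UNIV f"
| "Ck (Suc k) f \<longleftrightarrow>
     (\<forall>x. f differentiable (at x)) \<and> (\<forall>b\<in>Basis. Ck k (\<lambda>x. grad f x \<bullet> b))"

text \<open>Members of \<open>C_c^\<infinity>(\<Omega>)\<close> are taken extended by zero to the whole space.\<close>

definition test_function :: "'a::euclidean_space set \<Rightarrow> ('a \<Rightarrow> real) \<Rightarrow> bool" where
  "test_function \<Omega> \<phi> \<longleftrightarrow>
     (\<forall>k. Ck k \<phi>) \<and> compact (closure {x. \<phi> x \<noteq> 0}) \<and> closure {x. \<phi> x \<noteq> 0} \<subseteq> \<Omega>"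

definition Lspace ::
    "real \<Rightarrow> 'a::euclidean_space set \<Rightarrow> ('a \<Rightarrow> 'b::euclidean_space) set" where
  "Lspace q \<Omega> = {f. f \<in> borel_measurable (lebesgue_on \<Omega>) \<and>
                    integrable (lebesgue_on \<Omega>) (\<lambda>x. norm (f x) powr q)}"

definition locally_integrable ::
    "'a::euclidean_space set \<Rightarrow> ('a \<Rightarrow> 'b::euclidean_space) \<Rightarrow> bool" where
  "locally_integrable \<Omega> f \<longleftrightarrow>
     (\<forall>K. compact K \<and> K \<subseteq> \<Omega> \<longrightarrow> integrable (lebesgue_on K) f)"

definition has_weak_gradient ::
    "'a::euclidean_space set \<Rightarrow> ('a \<Rightarrow> real) \<Rightarrow> ('a \<Rightarrow> 'a) \<Rightarrow> bool" where
  "has_weak_gradient \<Omega> u G \<longleftrightarrow>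
     locally_integrable \<Omega> u \<and> locally_integrable \<Omega> G \<and>
     (\<forall>\<phi>. test_function \<Omega> \<phi> \<longrightarrow>
        (LINT x|lebesgue_on \<Omega>. u x *\<^sub>R grad \<phi> x) = - (LINT x|lebesgue_on \<Omega>. \<phi> x *\<^sub>R G x))"

text \<open>A weak gradient is unique up to a null set, so no integral below depends on the choice.\<close>

definition weak_grad :: "'a::euclidean_space set \<Rightarrow> ('a \<Rightarrow> real) \<Rightarrow> 'a \<Rightarrow> 'a" where
  "weak_grad \<Omega> u = (SOME G. has_weak_gradient \<Omega> u G)"

text \<open>\<open>H_0^1(\<Omega>)\<close> is the closure of \<open>C_c^\<infinity>(\<Omega>)\<close> in \<open>H^1(\<Omega>)\<close>.\<close>

definition H01 :: "'a::euclidean_space set \<Rightarrow> ('a \<Rightarrow> real) set" where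
  "H01 \<Omega> = {u \<in> Lspace 2 \<Omega>. \<exists>G \<in> Lspace 2 \<Omega>. has_weak_gradient \<Omega> u G \<and>
     (\<exists>\<phi>. (\<forall>n::nat. test_function \<Omega> (\<phi> n)) \<and>
        (\<lambda>n. LINT x|lebesgue_on \<Omega>. (\<phi> n x - u x)\<^sup>2) \<longlonglongrightarrow> 0 \<and>
        (\<lambda>n. LINT x|lebesgue_on \<Omega>. (norm (grad (\<phi> n) x - G x))\<^sup>2) \<longlonglongrightarrow> 0)}"

definition crit_exp :: "'a::euclidean_space itself \<Rightarrow> real" where
  "crit_exp _ = 2 * real DIM('a) / (real DIM('a) - 2)"

text \<open>
  The completion of \<open>C_c^\<infinity>(\<Omega>)\<close> for the norm \<open>(\<integral>|\<nabla>u|^2)^(1/2)\<close>, realised as a space of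
  functions in the usual way (dimension at least 3): by the Sobolev inequality a sequence of
  test functions that is Cauchy for this norm also converges in \<open>L^{2*}\<close>, \<open>2* = 2N/(N-2)\<close>, and
  the element of the completion it represents is identified with its \<open>L^{2*}\<close> limit \<open>u\<close>, the
  limit of the gradients being the weak gradient of \<open>u\<close>.
\<close>

definition D012 :: "'a::euclidean_space set \<Rightarrow> ('a \<Rightarrow> real) set" where
  "D012 \<Omega> = {u \<in> Lspace (crit_exp TYPE('a)) \<Omega>.
     \<exists>G \<in> Lspace 2 \<Omega>. has_weak_gradient \<Omega> u G \<and>
     (\<exists>\<phi>. (\<forall>n::nat. test_function \<Omega> (\<phi> n)) \<and>
        (\<lambda>n. LINT x|lebesgue_on \<Omega>. \<bar>\<phi> n x - u x\<bar> powr crit_exp TYPE('a)) \<longlonglongrightarrow> 0 \<and>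
        (\<lambda>n. LINT x|lebesgue_on \<Omega>. (norm (grad (\<phi> n) x - G x))\<^sup>2) \<longlonglongrightarrow> 0)}"

text \<open>
  \<open>energy_norm \<Omega> 1\<close> and \<open>energy_norm \<Omega> 0\<close> are the standard norms of \<open>H_0^1(\<Omega>)\<close> and
  \<open>D_0^{1,2}(\<Omega>)\<close>.
\<close>

definition energy_density ::
    "'a::euclidean_space set \<Rightarrow> real \<Rightarrow> ('a \<Rightarrow> real) \<Rightarrow> 'a \<Rightarrow> real" where
  "energy_density \<Omega> lam v x = (norm (weak_grad \<Omega> v x))\<^sup>2 + lam * (v x)\<^sup>2"

definition energy_norm :: "'a::euclidean_space set \<Rightarrow> real \<Rightarrow> ('a \<Rightarrow> real) \<Rightarrow> real" where
  "energy_norm \<Omega> lam v = sqrt (LINT x|lebesgue_on \<Omega>. energy_density \<Omega> lam v x)"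

definition norm_mod_AE ::
    "'a measure \<Rightarrow> ('a \<Rightarrow> real) set \<Rightarrow> (('a \<Rightarrow> real) \<Rightarrow> real) \<Rightarrow> bool" where
  "norm_mod_AE M H nrm \<longleftrightarrow>
     (\<forall>v\<in>H. 0 \<le> nrm v \<and> (nrm v = 0 \<longleftrightarrow> (AE x in M. v x = 0))) \<and>
     (\<forall>v\<in>H. \<forall>c. nrm (\<lambda>x. c * v x) = \<bar>c\<bar> * nrm v) \<and>
     (\<forall>v\<in>H. \<forall>w\<in>H. nrm (\<lambda>x. v x + w x) \<le> nrm v + nrm w)"

text \<open>
  The operator \<open>-\<Delta> + lam\<close> is well defined and coercive in \<open>H\<close>, whose standard norm is \<open>nrm\<close>.
  Integrability is stated separately because the Bochner integral is \<open>0\<close> for non-integrable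
  functions; nonnegativity because \<open>sqrt\<close> is total and odd.
\<close>

definition well_defined_coercive ::
    "'a::euclidean_space set \<Rightarrow> ('a \<Rightarrow> real) set \<Rightarrow> (('a \<Rightarrow> real) \<Rightarrow> real) \<Rightarrow> real \<Rightarrow> bool" where
  "well_defined_coercive \<Omega> H nrm lam \<longleftrightarrow>
     (\<forall>v\<in>H. integrable (lebesgue_on \<Omega>) (energy_density \<Omega> lam v) \<and>
            0 \<le> (LINT x|lebesgue_on \<Omega>. energy_density \<Omega> lam v x)) \<and>
     norm_mod_AE (lebesgue_on \<Omega>) H (energy_norm \<Omega> lam) \<and>
     (\<exists>a>0. \<exists>b>0. \<forall>v\<in>H. a * nrm v \<le> energy_norm \<Omega> lam v \<and> energy_norm \<Omega> lam v \<le> b * nrm v)"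

text \<open>
  \<open>-\<Delta>u + lam u = f\<close> in the weak (distributional) sense. No growth restriction relates the
  exponent of the nonlinearity to the dimension, so local integrability of \<open>f\<close> is part of the
  notion; it holds automatically for nonlinearities of at most critical growth.
\<close>

definition weak_solution ::
    "'a::euclidean_space set \<Rightarrow> real \<Rightarrow> ('a \<Rightarrow> real) \<Rightarrow> ('a \<Rightarrow> real) \<Rightarrow> bool" where
  "weak_solution \<Omega> lam u f \<longleftrightarrow> locally_integrable \<Omega> f \<and>
     (\<forall>\<phi>. test_function \<Omega> \<phi> \<longrightarrow>
        (LINT x|lebesgue_on \<Omega>. weak_grad \<Omega> u x \<bullet> grad \<phi> x + lam * u x * \<phi> x)
          = (LINT x|lebesgue_on \<Omega>. f x * \<phi> x))"

text \<open>
  In \<open>\<bar>t\<bar> powr (q - 2) * t\<close> the convention \<open>|t|^(q-2) t = 0\<close> for \<open>t = 0\<close> holds by itself.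
\<close>

definition equation_solution ::
    "'a::euclidean_space set \<Rightarrow> ('a \<Rightarrow> real) set \<Rightarrow> real \<Rightarrow> real \<Rightarrow> ('a \<Rightarrow> real) \<Rightarrow> bool" where
  "equation_solution \<Omega> H lam p u \<longleftrightarrow>
     u \<in> H \<and> weak_solution \<Omega> lam u (\<lambda>x. \<bar>u x\<bar> powr (2 * p - 2) * u x)"

definition system_solution ::
    "'a::euclidean_space set \<Rightarrow> ('a \<Rightarrow> real) set \<Rightarrow> real \<Rightarrow> real \<Rightarrow> real^'l^'l \<Rightarrow>
     ('l::finite \<Rightarrow> 'a \<Rightarrow> real) \<Rightarrow> bool" where
  "system_solution \<Omega> H lam p \<beta> u \<longleftrightarrow>
     (\<forall>i. u i \<in> H \<and>
        weak_solution \<Omega> lam (u i)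
          (\<lambda>x. \<Sum>j\<in>UNIV. \<beta> $ i $ j * \<bar>u j x\<bar> powr p * (\<bar>u i x\<bar> powr (p - 2) * u i x)))"

end

theory Submission
  imports Defs
begin

text \<open>
  If the system is tested on multiples \<open>u\<^sub>i = c\<^sub>i u\<close> of one function, the \<open>i\<close>-th right-hand side is
  \<open>(\<Sum>\<^sub>j \<beta>\<^sub>i\<^sub>j c\<^sub>j\<^sup>p) c\<^sub>i\<^sup>p\<^sup>-\<^sup>2\<close> times \<open>c\<^sub>i |u|\<^sup>2\<^sup>p\<^sup>-\<^sup>2 u\<close>. The left-hand side is linear, so everything reduces to finding positive
  amplitudes for which the first factor is \<open>1\<close> for every \<open>i\<close>; these do not depend on \<open>u\<close>.
  
  With \<open>s\<^sub>i = c\<^sub>i\<^sup>p\<close> and \<open>r = 2/p\<close> the amplitude system is \<open>(\<beta> s)\<^sub>i = s\<^sub>i\<^sup>r\<^sup>-\<^sup>1\<close>. It is variational: a maximizer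
  of the quadratic form \<open>s \<bullet> \<beta> s\<close> on the unit sphere of the \<open>\<ell>\<^sup>r\<close> norm can be taken nonnegative, since \<open>\<beta>\<close> has nonnegative
  entries, and satisfies \<open>(\<beta> s)\<^sub>i = K s\<^sub>i\<^sup>r\<^sup>-\<^sup>1\<close> with \<open>K > 0\<close>, even where \<open>s\<^sub>i = 0\<close>, because \<open>r > 1\<close>
  (\<open>nonlinear_eigenvector\<close>). Since \<open>r < 2\<close>, scaling removes \<open>K\<close>. The maximizer need not be positive,
  but at an index where it vanishes the equation forces every coupling to its support to vanish.
  The index set thus splits into the support and a decoupled remainder, on which the argument is
  repeated (\<open>nonlinear_fixed_point\<close>).
  
  On the analytic side, \<open>weak_solution_scale\<close> transports the weak equation from \<open>u\<close> to \<open>c u\<close>.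
  The one point to watch is that \<open>weak_grad\<close> selects some weak gradient, so that the one selected
  for \<open>c u\<close> need not be \<open>c\<close> times the one selected for \<open>u\<close>. The two agree when paired with
  \<open>grad \<phi>\<close>, because the components of \<open>grad \<phi>\<close> are again test functions
  (\<open>integral_weak_gradient_inner_grad_unique\<close>).
\<close>

section \<open>Positive solutions of the amplitude system\<close>

text \<open>
  At \<open>a = 0\<close> this uses \<open>r > 1\<close>: the difference quotient has size \<open>\<bar>t\<bar>\<close> to the power
  \<open>r - 1\<close>. Differentiability across \<open>0\<close> is what lets the Euler-Lagrange equations below be derived
  also at vanishing components.
\<close>

lemma has_real_derivative_abs_powr:
  fixes r a :: real
  assumes "r > 1" and "a \<ge> 0"
  shows "((\<lambda>t. \<bar>t\<bar> powr r) has_real_derivative r * a powr (r - 1)) (at a)"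
proof (cases "a = 0")
  case True
  have "((\<lambda>t::real. \<bar>t\<bar> powr (r - 1)) \<longlongrightarrow> 0 powr (r - 1)) (at 0)"
    using assms by (intro tendsto_powr' tendsto_eq_intros) auto
  then have "((\<lambda>t::real. \<bar>t\<bar> powr (r - 1)) \<longlongrightarrow> 0) (at 0)"
    by simp
  moreover have "\<bar>t\<bar> powr (r - 1) = norm (\<bar>t\<bar> powr r / t)" if "t \<noteq> 0" for t :: real
    using that by (simp add: powr_diff)
  ultimately have "((\<lambda>t::real. norm (\<bar>t\<bar> powr r / t)) \<longlongrightarrow> 0) (at 0)"
    by (auto intro!: Lim_transform_eventually[where f = "\<lambda>t. \<bar>t\<bar> powr (r - 1)"] simp: eventually_at_filter)
  then have "((\<lambda>t::real. \<bar>t\<bar> powr r / t) \<longlongrightarrow> 0) (at 0)"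
    by (rule tendsto_norm_zero_cancel)
  then show ?thesis
    using True assms by (simp add: has_field_derivative_iff)
next
  case False
  then have "a > 0" using assms by simp
  have "((\<lambda>t. t powr r) has_real_derivative r * a powr (r - 1)) (at a)"
    using \<open>a > 0\<close> by (rule has_real_derivative_powr)
  then show ?thesis
    by (rule has_field_derivative_transform_within_open[where S = "{0<..}"])
       (use \<open>a > 0\<close> in auto)
qed

lemma quadratic_form_le_abs:
  fixes A :: "real^'l^'l"
  assumes "\<And>i j. A $ i $ j \<ge> 0"
  shows "x \<bullet> (A *v x) \<le> (\<chi> i. \<bar>x $ i\<bar>) \<bullet> (A *v (\<chi> i. \<bar>x $ i\<bar>))"
proof -
  have "x $ i * (A $ i $ j * x $ j) \<le> \<bar>x $ i\<bar> * (A $ i $ j * \<bar>x $ j\<bar>)" for i j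
    using abs_ge_self[of "x $ i * (A $ i $ j * x $ j)"] assms[of i j] by (simp add: abs_mult)
  then show ?thesis
    by (simp add: inner_vec_def matrix_vector_mult_def sum_distrib_left sum_mono)
qed

lemma quadratic_form_axis:
  fixes A :: "real^'l^'l"
  shows "axis i 1 \<bullet> (A *v axis i 1) = A $ i $ i"
proof -
  have "axis i 1 \<bullet> (A *v axis i 1) = (A *v axis i 1) $ i"
    by (metis cart_eq_inner_axis inner_commute)
  then show ?thesis
    by (simp add: matrix_vector_mult_basis column_def)
qed

lemma quadratic_form_add_axis:
  fixes A :: "real^'l^'l"
  assumes "transpose A = A"
  shows "(x + t *\<^sub>R axis i 1) \<bullet> (A *v (x + t *\<^sub>R axis i 1))
    = x \<bullet> (A *v x) + 2 * t * (A *v x) $ i + t\<^sup>2 * A $ i $ i"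
proof -
  have "x \<bullet> (A *v axis i 1) = (A *v x) $ i"
    using dot_lmul_matrix[of x A "axis i 1"] assms
    by (metis cart_eq_inner_axis transpose_matrix_vector)
  moreover have "axis i 1 \<bullet> (A *v x) = (A *v x) $ i"
    by (metis cart_eq_inner_axis inner_commute)
  moreover have "axis i 1 \<bullet> (A *v axis i 1) = A $ i $ i"
    by (rule quadratic_form_axis)
  ultimately show ?thesis
    by (simp add: matrix_vector_right_distrib matrix_vector_mult_scaleR inner_add_left inner_add_right
        power2_eq_square algebra_simps)
qed

text \<open>
  The unit sphere of the \<open>\<ell>\<^sup>r\<close> norm in the coordinate subspace of \<open>S\<close> is compact, and replacing a maximizer of
  the quadratic form by its componentwise absolute value does not decrease the form because the
  entries are nonnegative. Homogeneity turns the constrained maximum into an inequality for all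
  vectors of the subspace, of either sign, so that no constraint remains when it is differentiated.
\<close>

lemma constrained_maximizer:
  fixes A :: "real^'l^'l" and r :: real
  assumes r: "1 < r"
    and nonneg: "\<And>i j. A $ i $ j \<ge> 0" and diag: "\<And>i. A $ i $ i > 0" and "S \<noteq> {}"
  obtains x where "\<And>i. x $ i \<ge> 0" "\<And>i. i \<notin> S \<Longrightarrow> x $ i = 0"
    "(\<Sum>i\<in>UNIV. \<bar>x $ i\<bar> powr r) = 1" "x \<bullet> (A *v x) > 0"
    "\<And>z. (\<And>i. i \<notin> S \<Longrightarrow> z $ i = 0) \<Longrightarrow>
       z \<bullet> (A *v z) \<le> x \<bullet> (A *v x) * (\<Sum>i\<in>UNIV. \<bar>z $ i\<bar> powr r) powr (2 / r)"
proof -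
  define N :: "real^'l \<Rightarrow> real" where "N z = (\<Sum>i\<in>UNIV. \<bar>z $ i\<bar> powr r)" for z
  define Q :: "real^'l \<Rightarrow> real" where "Q z = z \<bullet> (A *v z)" for z
  define C where "C = {z. N z = 1 \<and> (\<forall>i. i \<notin> S \<longrightarrow> z $ i = 0)}"
  obtain k where "k \<in> S" using \<open>S \<noteq> {}\<close> by blast
  have N_axis: "N (axis k 1) = 1"
  proof -
    have "N (axis k 1) = (\<Sum>i\<in>UNIV. if i = k then 1 else 0)"
      unfolding N_def by (rule sum.cong) (auto simp: axis_def)
    then show ?thesis by simp
  qed
  have axis_C: "axis k 1 \<in> C"
    using N_axis \<open>k \<in> S\<close> by (auto simp: C_def axis_def)
  have cont_N: "continuous_on UNIV N"
    unfolding N_def using r by (intro continuous_intros continuous_on_powr') auto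
  have cont_Q: "continuous_on UNIV Q"
    unfolding Q_def by (intro continuous_intros)
  have "closed C"
  proof -
    have "C = N -` {1} \<inter> (\<Inter>i\<in>-S. {z. z $ i = 0})"
      by (auto simp: C_def)
    moreover have "closed (N -` {1})"
      using cont_N by (simp add: closed_vimage continuous_on_eq_continuous_at)
    moreover have "closed {z :: real^'l. z $ i = 0}" for i
      by (intro closed_Collect_eq continuous_intros)
    ultimately show ?thesis by auto
  qed
  moreover have "bounded C"
  proof -
    have "norm z \<le> real CARD('l)" if "z \<in> C" for z
    proof -
      have "\<bar>z $ i\<bar> \<le> 1" for i
      proof (rule ccontr)
        assume "\<not> \<bar>z $ i\<bar> \<le> 1"
        then have "1 < \<bar>z $ i\<bar> powr r"
          using r powr_less_mono2[of r 1 "\<bar>z $ i\<bar>"] by simp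
        also have "\<dots> \<le> N z"
          unfolding N_def by (intro member_le_sum) auto
        finally show False using that by (simp add: C_def)
      qed
      then have "(\<Sum>i\<in>UNIV. \<bar>z $ i\<bar>) \<le> (\<Sum>i\<in>(UNIV::'l set). 1)"
        by (intro sum_mono)
      with norm_le_l1_cart[of z] show ?thesis by simp
    qed
    then show ?thesis by (rule boundedI)
  qed
  ultimately have "compact C" by (simp add: compact_eq_bounded_closed)
  then obtain y where y: "y \<in> C" "\<And>z. z \<in> C \<Longrightarrow> Q z \<le> Q y"
    using continuous_attains_sup[of C Q] axis_C cont_Q continuous_on_subset by blast
  define x where "x = (\<chi> i. \<bar>y $ i\<bar>)"
  have "Q (axis k 1) = A $ k $ k"
    unfolding Q_def by (rule quadratic_form_axis)
  then have "Q y > 0"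
    using y(2)[OF axis_C] diag[of k] by simp
  have "Q y \<le> Q x"
    unfolding Q_def x_def using nonneg by (rule quadratic_form_le_abs)
  have bound: "Q z \<le> Q x * N z powr (2 / r)" if supp: "\<And>i. i \<notin> S \<Longrightarrow> z $ i = 0" for z
  proof (cases "z = 0")
    case True
    then show ?thesis
      using \<open>Q y \<le> Q x\<close> \<open>Q y > 0\<close> by (simp add: Q_def)
  next
    case False
    then obtain j where "z $ j \<noteq> 0" by (auto simp: vec_eq_iff)
    have "0 < \<bar>z $ j\<bar> powr r" using \<open>z $ j \<noteq> 0\<close> by simp
    also have "\<dots> \<le> N z"
      unfolding N_def by (intro member_le_sum) auto
    finally have "N z > 0" .
    define d where "d = N z powr (- (1 / r))"
    have "d > 0" using \<open>N z > 0\<close> by (simp add: d_def)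
    have "N (d *\<^sub>R z) = d powr r * N z"
      using \<open>d > 0\<close> by (simp add: N_def abs_mult powr_mult sum_distrib_left)
    also have "d powr r = inverse (N z)"
      unfolding d_def powr_powr using r \<open>N z > 0\<close> by (simp add: powr_minus)
    finally have "d *\<^sub>R z \<in> C"
      using \<open>N z > 0\<close> supp by (simp add: C_def)
    then have "Q (d *\<^sub>R z) \<le> Q x"
      using y(2) \<open>Q y \<le> Q x\<close> by fastforce
    moreover have "Q (d *\<^sub>R z) = d\<^sup>2 * Q z"
      by (simp add: Q_def matrix_vector_mult_scaleR power2_eq_square)
    moreover have "d\<^sup>2 = inverse (N z powr (2 / r))"
      unfolding d_def power2_eq_square powr_add[symmetric] powr_minus[symmetric] by simp
    ultimately have "inverse (N z powr (2 / r)) * Q z \<le> Q x"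
      by simp
    then show ?thesis
      using \<open>N z > 0\<close> by (simp add: divide_le_eq inverse_eq_divide)
  qed
  show thesis
  proof
    show "x $ i \<ge> 0" for i by (simp add: x_def)
    show "x $ i = 0" if "i \<notin> S" for i using that y(1) by (simp add: x_def C_def)
    show "(\<Sum>i\<in>UNIV. \<bar>x $ i\<bar> powr r) = 1" using y(1) by (simp add: x_def C_def N_def)
    show "x \<bullet> (A *v x) > 0" using \<open>Q y > 0\<close> \<open>Q y \<le> Q x\<close> by (simp add: Q_def)
    show "z \<bullet> (A *v z) \<le> x \<bullet> (A *v x) * (\<Sum>i\<in>UNIV. \<bar>z $ i\<bar> powr r) powr (2 / r)"
      if "\<And>i. i \<notin> S \<Longrightarrow> z $ i = 0" for z
      using bound[OF that] by (simp add: Q_def N_def)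
  qed
qed

text \<open>
  These are the Euler-Lagrange equations of the maximizer. They hold at every index of \<open>S\<close>,
  including those where \<open>x\<close> vanishes; there they say that the nonnegative number \<open>(A x)\<^sub>i\<close> is zero.
  Vanishing components do occur: for a diagonal matrix and \<open>r < 2\<close> the maximizer is a coordinate
  vector.
\<close>

lemma nonlinear_eigenvector:
  fixes A :: "real^'l^'l" and r :: real
  assumes r: "1 < r" and sym: "transpose A = A"
    and nonneg: "\<And>i j. A $ i $ j \<ge> 0" and diag: "\<And>i. A $ i $ i > 0" and "S \<noteq> {}"
  obtains x K where "K > 0" "x \<noteq> 0" "\<And>i. x $ i \<ge> 0" "\<And>i. i \<notin> S \<Longrightarrow> x $ i = 0"
    "\<And>i. i \<in> S \<Longrightarrow> (A *v x) $ i = K * x $ i powr (r - 1)"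
proof -
  obtain x where x: "\<And>i. x $ i \<ge> 0" "\<And>i. i \<notin> S \<Longrightarrow> x $ i = 0"
    "(\<Sum>i\<in>UNIV. \<bar>x $ i\<bar> powr r) = 1" "x \<bullet> (A *v x) > 0"
    and bound: "\<And>z. (\<And>i. i \<notin> S \<Longrightarrow> z $ i = 0) \<Longrightarrow>
       z \<bullet> (A *v z) \<le> x \<bullet> (A *v x) * (\<Sum>i\<in>UNIV. \<bar>z $ i\<bar> powr r) powr (2 / r)"
    using constrained_maximizer[OF r nonneg diag \<open>S \<noteq> {}\<close>] by blast
  define N :: "real^'l \<Rightarrow> real" where "N z = (\<Sum>i\<in>UNIV. \<bar>z $ i\<bar> powr r)" for z
  define K where "K = x \<bullet> (A *v x)"
  have eq: "(A *v x) $ i = K * x $ i powr (r - 1)" if "i \<in> S" for i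
  proof -
    define P where "P t = 1 - x $ i powr r + \<bar>x $ i + t\<bar> powr r" for t
    define h where "h t = K * P t powr (2 / r) - (K + 2 * t * (A *v x) $ i + t\<^sup>2 * A $ i $ i)" for t
    have N_line: "N (x + t *\<^sub>R axis i 1) = P t" for t
    proof -
      have "N (x + t *\<^sub>R axis i 1) = \<bar>x $ i + t\<bar> powr r + (\<Sum>j\<in>UNIV - {i}. \<bar>x $ j\<bar> powr r)"
        unfolding N_def by (subst sum.remove[of _ i]) (auto simp: axis_def intro!: sum.cong)
      moreover have "N x = x $ i powr r + (\<Sum>j\<in>UNIV - {i}. \<bar>x $ j\<bar> powr r)"
        unfolding N_def using x(1) by (subst sum.remove[of _ i]) auto
      ultimately show ?thesis using x(3) by (simp add: P_def N_def)
    qed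
    have h_nonneg: "h t \<ge> 0" for t
    proof -
      have "(x + t *\<^sub>R axis i 1) $ j = 0" if "j \<notin> S" for j
        using that \<open>i \<in> S\<close> x(2) by (auto simp: axis_def)
      from bound[OF this, folded N_def] show ?thesis
        unfolding N_line quadratic_form_add_axis[OF sym] h_def K_def by linarith
    qed
    \<comment> \<open>Moving the single coordinate \<open>i\<close> leaves \<open>h\<close> nonnegative with value \<open>0\<close> at \<open>t = 0\<close>.\<close>
    have "((\<lambda>t. \<bar>x $ i + t\<bar> powr r) has_real_derivative r * x $ i powr (r - 1)) (at 0)"
      using has_real_derivative_abs_powr[OF r x(1)[of i]] DERIV_shift[of "\<lambda>t. \<bar>t\<bar> powr r" _ 0 "x $ i"]
      by (simp add: add.commute)
    then have "(P has_real_derivative r * x $ i powr (r - 1)) (at 0)"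
      unfolding P_def using DERIV_add[OF DERIV_const] by fastforce
    moreover have P0: "P 0 = 1"
      using x(1)[of i] by (simp add: P_def)
    ultimately have "((\<lambda>t. P t powr (2 / r)) has_real_derivative 2 * x $ i powr (r - 1)) (at 0)"
      using DERIV_fun_powr[of P "r * x $ i powr (r - 1)" 0 "2 / r"] r by simp
    then have "((\<lambda>t. K * P t powr (2 / r)) has_real_derivative K * (2 * x $ i powr (r - 1))) (at 0)"
      by (rule DERIV_cmult)
    moreover have "((\<lambda>t. K + 2 * t * (A *v x) $ i + t\<^sup>2 * A $ i $ i)
        has_real_derivative 2 * (A *v x) $ i) (at 0)"
      by (auto intro!: derivative_eq_intros)
    ultimately have "(h has_real_derivative K * (2 * x $ i powr (r - 1)) - 2 * (A *v x) $ i) (at 0)"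
      unfolding h_def by (rule DERIV_diff)
    moreover have "h 0 = 0"
      using P0 by (simp add: h_def)
    ultimately have "K * (2 * x $ i powr (r - 1)) - 2 * (A *v x) $ i = 0"
      using DERIV_local_min[of h _ 0 1] h_nonneg by fastforce
    then show ?thesis by simp
  qed
  show thesis
  proof (rule that)
    show "K > 0" using x(4) by (simp add: K_def)
    show "x \<noteq> 0" using x(4) by auto
  qed (use eq x in auto)
qed

text \<open>
  An eigenvector \<open>x\<close> supported in \<open>S\<close>, scaled so that its eigenvalue becomes \<open>1\<close>, solves the
  equations on \<open>S\<close> but may vanish on a proper subset \<open>Z\<close> of \<open>S\<close>. For \<open>i \<in> Z\<close> the equation reads
  \<open>(A x)\<^sub>i = 0\<close>, a sum of nonnegative terms, so \<open>A\<close> does not couple \<open>Z\<close> to the support of \<open>x\<close>; by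
  symmetry the support is not coupled to \<open>Z\<close> either. Adding the solution that the induction
  hypothesis gives on \<open>Z\<close> therefore disturbs no equation.
\<close>

lemma nonlinear_fixed_point:
  fixes A :: "real^'l^'l" and r :: real
  assumes r: "1 < r" "r < 2" and sym: "transpose A = A"
    and nonneg: "\<And>i j. A $ i $ j \<ge> 0" and diag: "\<And>i. A $ i $ i > 0"
  shows "\<exists>x. (\<forall>i\<in>S. x $ i > 0 \<and> (A *v x) $ i = x $ i powr (r - 1)) \<and> (\<forall>i. i \<notin> S \<longrightarrow> x $ i = 0)"
  using finite[of S]
proof (induction S rule: finite_psubset_induct)
  case (psubset S)
  show ?case
  proof (cases "S = {}")
    case True
    then show ?thesis by (intro exI[of _ 0]) simp
  next
    case False
    obtain y K where y: "K > 0" "y \<noteq> 0" "\<And>i. y $ i \<ge> 0" "\<And>i. i \<notin> S \<Longrightarrow> y $ i = 0"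
      "\<And>i. i \<in> S \<Longrightarrow> (A *v y) $ i = K * y $ i powr (r - 1)"
      by (rule nonlinear_eigenvector[OF r(1) sym nonneg diag False]) (rule that)
    \<comment> \<open>Scaling by \<open>d\<close> multiplies the left side by \<open>d\<close> and the power by \<open>d powr (r - 1)\<close>;
      since \<open>r \<noteq> 2\<close>, the eigenvalue \<open>K\<close> can be absorbed.\<close>
    define d where "d = K powr (- (1 / (2 - r)))"
    have "d > 0" using y(1) by (simp add: d_def)
    have "d powr (2 - r) = inverse K"
      unfolding d_def powr_powr using y(1) r by (simp add: powr_minus)
    moreover have "d powr (2 - r) * d powr (r - 1) = d"
      using \<open>d > 0\<close> by (simp flip: powr_add)
    ultimately have "inverse K * d powr (r - 1) = d"
      by simp
    then have d_powr: "d powr (r - 1) = d * K"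
      using y(1) by (auto simp: field_simps)
    define x where "x = d *\<^sub>R y"
    have x: "x \<noteq> 0" "\<And>i. x $ i \<ge> 0" "\<And>i. i \<notin> S \<Longrightarrow> x $ i = 0"
      using y \<open>d > 0\<close> by (auto simp: x_def)
    have Ax: "(A *v x) $ i = x $ i powr (r - 1)" if "i \<in> S" for i
      using y(3)[of i] y(5)[OF that] \<open>d > 0\<close>
      by (simp add: x_def matrix_vector_mult_scaleR powr_mult d_powr)
    define Z where "Z = {i \<in> S. x $ i = 0}"
    obtain k where "x $ k \<noteq> 0" using x(1) by (auto simp: vec_eq_iff)
    then have "k \<in> S" "k \<notin> Z" using x(3) by (auto simp: Z_def)
    then have "Z \<subset> S" by (auto simp: Z_def)
    obtain z where z: "\<And>i. i \<in> Z \<Longrightarrow> z $ i > 0 \<and> (A *v z) $ i = z $ i powr (r - 1)"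
      "\<And>i. i \<notin> Z \<Longrightarrow> z $ i = 0"
      using psubset.IH[OF \<open>Z \<subset> S\<close>] by fast
    have decoupled: "A $ i $ j * x $ j = 0" if "i \<in> Z" for i j
    proof -
      have "(\<Sum>j\<in>UNIV. A $ i $ j * x $ j) = 0"
        using Ax[of i] that r by (simp add: Z_def matrix_vector_mult_def)
      then show ?thesis
        using nonneg x(2) by (subst (asm) sum_nonneg_eq_0_iff) auto
    qed
    have "A $ i $ j = A $ j $ i" for i j
      using arg_cong[OF sym, of "\<lambda>B. B $ i $ j"] by (simp add: transpose_def)
    then have "A $ i $ j * z $ j = 0" if "x $ i > 0" for i j
      using decoupled[of j i] that z(2)[of j] by (cases "j \<in> Z") auto
    then have Az: "(A *v z) $ i = 0" if "x $ i > 0" for i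
      using that by (auto simp: matrix_vector_mult_def intro!: sum.neutral)
    show ?thesis
    proof (intro exI[of _ "x + z"] conjI ballI allI impI)
      fix i assume "i \<in> S"
      have Axz: "(A *v (x + z)) $ i = x $ i powr (r - 1) + (A *v z) $ i"
        using Ax[OF \<open>i \<in> S\<close>] by (simp add: matrix_vector_right_distrib)
      show "(x + z) $ i > 0"
        using x(2)[of i] z(1)[of i] z(2)[of i] \<open>i \<in> S\<close> by (cases "i \<in> Z") (auto simp: Z_def less_le)
      show "(A *v (x + z)) $ i = (x + z) $ i powr (r - 1)"
      proof (cases "i \<in> Z")
        case True
        then have "x $ i = 0" by (simp add: Z_def)
        then show ?thesis using z(1)[OF True] Axz by simp
      next
        case False
        then have "x $ i > 0" using x(2)[of i] \<open>i \<in> S\<close> by (simp add: Z_def less_le)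
        then show ?thesis using Az[of i] z(2)[OF False] Axz by simp
      qed
    next
      fix i assume "i \<notin> S"
      then show "(x + z) $ i = 0" using x(3) z(2) by (auto simp: Z_def)
    qed
  qed
qed

text \<open>
  In the unknowns \<open>s\<^sub>i = c\<^sub>i powr p\<close> the algebraic system for the amplitudes becomes
  \<open>(A s)\<^sub>i = s\<^sub>i powr (2 / p - 1)\<close>, and \<open>r = 2 / p\<close> lies between \<open>1\<close> and \<open>2\<close> exactly when \<open>1 < p < 2\<close>.
\<close>

lemma coupling_amplitudes:
  fixes A :: "real^'l^'l" and p :: real
  assumes p: "1 < p" "p < 2" and sym: "transpose A = A"
    and nonneg: "\<And>i j. A $ i $ j \<ge> 0" and diag: "\<And>i. A $ i $ i > 0"
  obtains c :: "real^'l" where "\<And>i. c $ i > 0"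
    "\<And>i. (\<Sum>j\<in>UNIV. A $ i $ j * c $ j powr p) * c $ i powr (p - 2) = 1"
proof -
  have "1 < 2 / p" "2 / p < 2" using p by (simp_all add: field_simps)
  from nonlinear_fixed_point[OF this sym nonneg diag, of UNIV] obtain s where
    s: "\<And>i. s $ i > 0" "\<And>i. (A *v s) $ i = s $ i powr (2 / p - 1)"
    by auto
  define c where "c = (\<chi> i. s $ i powr (1 / p))"
  have "c $ i > 0" for i using s(1)[of i] by (simp add: c_def)
  moreover have "(\<Sum>j\<in>UNIV. A $ i $ j * c $ j powr p) * c $ i powr (p - 2) = 1" for i
  proof -
    have "(\<Sum>j\<in>UNIV. A $ i $ j * c $ j powr p) = (A *v s) $ i"
      using p s(1) by (simp add: c_def powr_powr matrix_vector_mult_def less_imp_le)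
    moreover have "c $ i powr (p - 2) = s $ i powr (- (2 / p - 1))"
      using p by (simp add: c_def powr_powr diff_divide_distrib)
    ultimately show ?thesis
      using s(1)[of i] by (simp add: s(2) flip: powr_add)
  qed
  ultimately show thesis using that by blast
qed

text \<open>
  Every coupling term is homogeneous of degree \<open>2 * p - 1\<close> in the common profile, so on multiples of a
  single function the system decouples as soon as the amplitudes satisfy the algebraic system.
\<close>

lemma system_nonlinearity_scale:
  fixes b c :: "'l::finite \<Rightarrow> real" and t :: real
  assumes "\<And>j. c j > 0" and "(\<Sum>j\<in>UNIV. b j * c j powr p) * c i powr (p - 2) = 1"
  shows "(\<Sum>j\<in>UNIV. b j * \<bar>c j * t\<bar> powr p * (\<bar>c i * t\<bar> powr (p - 2) * (c i * t)))
    = c i * (\<bar>t\<bar> powr (2 * p - 2) * t)"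
proof -
  have "\<bar>t\<bar> powr (2 * p - 2) = \<bar>t\<bar> powr p * \<bar>t\<bar> powr (p - 2)"
    by (simp flip: powr_add)
  then have "b j * \<bar>c j * t\<bar> powr p * (\<bar>c i * t\<bar> powr (p - 2) * (c i * t))
      = (b j * c j powr p) * (c i powr (p - 2) * c i * (\<bar>t\<bar> powr (2 * p - 2) * t))" for j
    using assms(1)[of i] assms(1)[of j] by (simp add: abs_mult powr_mult mult_ac)
  then have "(\<Sum>j\<in>UNIV. b j * \<bar>c j * t\<bar> powr p * (\<bar>c i * t\<bar> powr (p - 2) * (c i * t)))
      = ((\<Sum>j\<in>UNIV. b j * c j powr p) * c i powr (p - 2)) * (c i * (\<bar>t\<bar> powr (2 * p - 2) * t))"
    by (simp only: sum_distrib_right mult.assoc)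
  then show ?thesis
    using assms(2) by simp
qed


section \<open>Gradients and test functions\<close>

lemma grad_eqI:
  assumes "GDERIV f x :> D"
  shows "grad f x = D"
  unfolding grad_def
proof (rule the_equality)
  show "GDERIV f x :> D" by (rule assms)
next
  fix E assume "GDERIV f x :> E"
  then have "(\<lambda>h. h \<bullet> E) = (\<lambda>h. h \<bullet> D)"
    using assms unfolding gderiv_def by (rule has_derivative_unique)
  then show "E = D"
    by (metis inner_commute vector_eq_rdot)
qed

lemma GDERIV_grad:
  fixes f :: "'a::euclidean_space \<Rightarrow> real"
  assumes "f differentiable (at x)"
  shows "GDERIV f x :> grad f x"
proof -
  obtain f' where f': "(f has_derivative f') (at x)"
    using assms by (auto simp: differentiable_def)
  then have "linear f'" by (rule has_derivative_linear)
  then have "f' = (\<lambda>h. h \<bullet> adjoint f' 1)"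
    by (auto simp: adjoint_works)
  then have "GDERIV f x :> adjoint f' 1"
    using f' by (metis gderiv_def)
  then show ?thesis
    using grad_eqI by metis
qed

lemma grad_scale:
  fixes f :: "'a::euclidean_space \<Rightarrow> real"
  assumes "f differentiable (at x)"
  shows "grad (\<lambda>y. c * f y) x = c *\<^sub>R grad f x"
proof (rule grad_eqI)
  show "GDERIV (\<lambda>y. c * f y) x :> c *\<^sub>R grad f x"
    using GDERIV_grad[OF assms] unfolding gderiv_def
    by (auto intro: has_derivative_mult_right)
qed

lemma Ck_scale: "Ck k f \<Longrightarrow> Ck k (\<lambda>x. c * f x)"
proof (induction k arbitrary: f)
  case 0
  then show ?case by (auto intro: continuous_intros)
next
  case (Suc k)
  then show ?case by (auto simp: grad_scale)
qed

lemma Ck_imp_continuous: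
  assumes "Ck k f"
  shows "continuous_on UNIV f"
  using assms
  by (cases k) (auto intro: differentiable_imp_continuous_on simp: differentiable_on_def
      differentiable_at_withinI)

lemma test_function_continuous:
  "test_function \<Omega> \<phi> \<Longrightarrow> continuous_on UNIV \<phi>"
  using Ck_imp_continuous unfolding test_function_def by blast

lemma test_function_differentiable:
  "test_function \<Omega> \<phi> \<Longrightarrow> \<phi> differentiable (at x)"
  unfolding test_function_def by (metis Ck.simps(2))

lemma test_function_mono_support:
  assumes "test_function \<Omega> \<phi>" and "\<And>k. Ck k \<psi>"
    and "{x. \<psi> x \<noteq> 0} \<subseteq> closure {x. \<phi> x \<noteq> 0}"
  shows "test_function \<Omega> \<psi>"
proof -
  have "closure {x. \<psi> x \<noteq> 0} \<subseteq> closure {x. \<phi> x \<noteq> 0}"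
    using assms(3) by (simp add: closure_minimal)
  moreover from this have "compact (closure {x. \<psi> x \<noteq> 0})"
    using assms(1) unfolding test_function_def
    by (metis closed_closure compact_Int_closed inf.absorb2)
  ultimately show ?thesis
    using assms(1,2) by (auto simp: test_function_def)
qed

lemma test_function_scale:
  assumes "test_function \<Omega> \<phi>"
  shows "test_function \<Omega> (\<lambda>x. c * \<phi> x)"
proof (rule test_function_mono_support[OF assms])
  show "Ck k (\<lambda>x. c * \<phi> x)" for k
    using assms Ck_scale unfolding test_function_def by blast
  show "{x. c * \<phi> x \<noteq> 0} \<subseteq> closure {x. \<phi> x \<noteq> 0}"
    using closure_subset by fastforce
qed

lemma test_function_grad_component:
  assumes "test_function \<Omega> \<phi>" and "b \<in> Basis"
  shows "test_function \<Omega> (\<lambda>x. grad \<phi> x \<bullet> b)"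
proof (rule test_function_mono_support[OF assms(1)])
  show "Ck k (\<lambda>x. grad \<phi> x \<bullet> b)" for k
    using assms unfolding test_function_def by (metis Ck.simps(2))
  \<comment> \<open>Off the closed support, \<open>\<phi>\<close> vanishes in a neighbourhood.\<close>
  have "grad \<phi> x = 0" if "x \<notin> closure {x. \<phi> x \<noteq> 0}" for x
  proof (rule grad_eqI)
    have "((\<lambda>y. 0::real) has_derivative (\<lambda>h. h \<bullet> 0)) (at x)"
      by simp
    then show "GDERIV \<phi> x :> 0"
      unfolding gderiv_def
    proof (rule has_derivative_transform_within_open)
      show "open (- closure {x. \<phi> x \<noteq> 0})" by auto
      show "x \<in> - closure {x. \<phi> x \<noteq> 0}" using that by simp
      show "0 = \<phi> y" if "y \<in> - closure {x. \<phi> x \<noteq> 0}" for y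
        using that closure_subset[of "{x. \<phi> x \<noteq> 0}"] by force
    qed
  qed
  then show "{x. grad \<phi> x \<bullet> b \<noteq> 0} \<subseteq> closure {x. \<phi> x \<noteq> 0}"
    by force
qed

text \<open>
  The product lives on the compact support of \<open>\<phi>\<close>, where \<open>\<phi>\<close> is bounded and \<open>G\<close> integrable.
\<close>

lemma integrable_test_function_scaleR:
  fixes G :: "'a::euclidean_space \<Rightarrow> 'b::euclidean_space"
  assumes "open \<Omega>" and G: "locally_integrable \<Omega> G" and \<phi>: "test_function \<Omega> \<phi>"
  shows "integrable (lebesgue_on \<Omega>) (\<lambda>x. \<phi> x *\<^sub>R G x)"
proof -
  define K where "K = closure {x. \<phi> x \<noteq> 0}"
  have K: "compact K" "K \<subseteq> \<Omega>"
    using \<phi> by (simp_all add: test_function_def K_def)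
  have \<phi>_zero: "\<phi> x = 0" if "x \<notin> K" for x
    using that closure_subset[of "{x. \<phi> x \<noteq> 0}"] by (auto simp: K_def)
  have K_meas: "K \<in> sets lebesgue" "\<Omega> \<in> sets lebesgue"
    using K(1) \<open>open \<Omega>\<close> by (simp_all add: borel_compact)
  have cont: "continuous_on K \<phi>"
    using test_function_continuous[OF \<phi>] continuous_on_subset by blast
  then obtain B where B: "\<And>x. x \<in> K \<Longrightarrow> norm (\<phi> x) \<le> B"
    using K(1) compact_continuous_image compact_imp_bounded bounded_iff by (metis imageI)
  have G_int: "integrable (lebesgue_on K) G"
    using G K unfolding locally_integrable_def by blast
  have "integrable (lebesgue_on K) (\<lambda>x. \<phi> x *\<^sub>R G x)"
  proof (rule Bochner_Integration.integrable_bound)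
    show "integrable (lebesgue_on K) (\<lambda>x. B *\<^sub>R G x)"
      using G_int by simp
    show "(\<lambda>x. \<phi> x *\<^sub>R G x) \<in> borel_measurable (lebesgue_on K)"
      using G_int continuous_imp_measurable_on_sets_lebesgue[OF cont K_meas(1)]
      by (intro borel_measurable_scaleR) auto
    show "AE x in lebesgue_on K. norm (\<phi> x *\<^sub>R G x) \<le> norm (B *\<^sub>R G x)"
      using B by (intro AE_I2) (fastforce intro: mult_right_mono)
  qed
  then have "integrable lebesgue (\<lambda>x. indicat_real K x *\<^sub>R (\<phi> x *\<^sub>R G x))"
    using K_meas by (simp add: integrable_restrict_space)
  also have "(\<lambda>x. indicat_real K x *\<^sub>R (\<phi> x *\<^sub>R G x)) = (\<lambda>x. indicat_real \<Omega> x *\<^sub>R (\<phi> x *\<^sub>R G x))"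
    using K(2) \<phi>_zero by (auto simp: fun_eq_iff indicator_def)
  finally show ?thesis
    using K_meas by (simp add: integrable_restrict_space)
qed

section \<open>Scaling of weak gradients and weak solutions\<close>

lemma locally_integrable_scale:
  fixes c :: real
  shows "locally_integrable \<Omega> f \<Longrightarrow> locally_integrable \<Omega> (\<lambda>x. c *\<^sub>R f x)"
  by (simp add: locally_integrable_def)

lemma has_weak_gradient_scale:
  assumes "has_weak_gradient \<Omega> u G"
  shows "has_weak_gradient \<Omega> (\<lambda>x. c * u x) (\<lambda>x. c *\<^sub>R G x)"
proof -
  have "(LINT x|lebesgue_on \<Omega>. (c * u x) *\<^sub>R grad \<phi> x)
      = - (LINT x|lebesgue_on \<Omega>. \<phi> x *\<^sub>R c *\<^sub>R G x)" if "test_function \<Omega> \<phi>" for \<phi>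
  proof -
    have "(LINT x|lebesgue_on \<Omega>. (c * u x) *\<^sub>R grad \<phi> x) = c *\<^sub>R (LINT x|lebesgue_on \<Omega>. u x *\<^sub>R grad \<phi> x)"
      by (simp flip: scaleR_scaleR)
    also have "\<dots> = - (c *\<^sub>R (LINT x|lebesgue_on \<Omega>. \<phi> x *\<^sub>R G x))"
      using assms that by (simp add: has_weak_gradient_def)
    also have "\<dots> = - (LINT x|lebesgue_on \<Omega>. \<phi> x *\<^sub>R c *\<^sub>R G x)"
      by (simp only: scaleR_left_commute[of _ c] integral_scaleR_right)
    finally show ?thesis .
  qed
  then show ?thesis
    using assms locally_integrable_scale[of \<Omega> u c] locally_integrable_scale[of \<Omega> G c]
    by (simp add: has_weak_gradient_def)
qed

text \<open>
  Expanding in coordinates reduces the pairing with \<open>grad \<phi>\<close> to the pairings with the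
  components of \<open>grad \<phi>\<close>, which are test functions themselves.
\<close>

lemma integral_inner_grad:
  assumes "open \<Omega>" and "locally_integrable \<Omega> G" and "test_function \<Omega> \<phi>"
  shows "integrable (lebesgue_on \<Omega>) (\<lambda>x. G x \<bullet> grad \<phi> x)"
    and "(LINT x|lebesgue_on \<Omega>. G x \<bullet> grad \<phi> x)
      = (\<Sum>b\<in>Basis. (LINT x|lebesgue_on \<Omega>. (grad \<phi> x \<bullet> b) *\<^sub>R G x) \<bullet> b)"
proof -
  have int: "integrable (lebesgue_on \<Omega>) (\<lambda>x. (grad \<phi> x \<bullet> b) *\<^sub>R G x)" if "b \<in> Basis" for b
    by (intro integrable_test_function_scaleR assms test_function_grad_component that)
  have expand: "G x \<bullet> grad \<phi> x = (\<Sum>b\<in>Basis. ((grad \<phi> x \<bullet> b) *\<^sub>R G x) \<bullet> b)" for x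
    by (subst euclidean_inner) (simp add: mult.commute)
  show "integrable (lebesgue_on \<Omega>) (\<lambda>x. G x \<bullet> grad \<phi> x)"
    unfolding expand using int by (intro Bochner_Integration.integrable_sum integrable_inner_left) auto
  show "(LINT x|lebesgue_on \<Omega>. G x \<bullet> grad \<phi> x)
      = (\<Sum>b\<in>Basis. (LINT x|lebesgue_on \<Omega>. (grad \<phi> x \<bullet> b) *\<^sub>R G x) \<bullet> b)"
    unfolding expand using int
    by (simp only: Bochner_Integration.integral_sum integrable_inner_left integral_inner_left cong: sum.cong)
qed

text \<open>
  Two weak gradients of \<open>u\<close> have equal integrals against every test function, by definition, and the
  components of \<open>grad \<phi>\<close> are test functions; equality almost everywhere need not be known. This is what makes the choice inside \<open>weak_grad\<close> harmless
  under scaling.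
\<close>

lemma integral_weak_gradient_inner_grad_unique:
  assumes "open \<Omega>" and G: "has_weak_gradient \<Omega> u G" and G': "has_weak_gradient \<Omega> u G'"
    and \<phi>: "test_function \<Omega> \<phi>"
  shows "(LINT x|lebesgue_on \<Omega>. G x \<bullet> grad \<phi> x) = (LINT x|lebesgue_on \<Omega>. G' x \<bullet> grad \<phi> x)"
proof -
  have "(LINT x|lebesgue_on \<Omega>. (grad \<phi> x \<bullet> b) *\<^sub>R G x)
      = (LINT x|lebesgue_on \<Omega>. (grad \<phi> x \<bullet> b) *\<^sub>R G' x)" if "b \<in> Basis" for b
    using G G' test_function_grad_component[OF \<phi> that]
    unfolding has_weak_gradient_def by (metis neg_equal_iff_equal)
  moreover have "locally_integrable \<Omega> G" "locally_integrable \<Omega> G'"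
    using G G' by (simp_all add: has_weak_gradient_def)
  ultimately show ?thesis
    using assms by (simp add: integral_inner_grad(2))
qed

lemma has_weak_gradient_weak_grad:
  "has_weak_gradient \<Omega> u G \<Longrightarrow> has_weak_gradient \<Omega> u (weak_grad \<Omega> u)"
  unfolding weak_grad_def by (rule someI[where P = "has_weak_gradient \<Omega> u"])

lemma weak_solution_scale:
  assumes "open \<Omega>" and G: "has_weak_gradient \<Omega> u G" and sol: "weak_solution \<Omega> lam u f"
  shows "weak_solution \<Omega> lam (\<lambda>x. c * u x) (\<lambda>x. c * f x)"
  unfolding weak_solution_def
proof (intro conjI allI impI)
  show "locally_integrable \<Omega> (\<lambda>x. c * f x)"
    using sol locally_integrable_scale[of \<Omega> f c] by (simp add: weak_solution_def)
next
  fix \<phi> assume \<phi>: "test_function \<Omega> \<phi>"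
  define W where "W = weak_grad \<Omega> u"
  define Wc where "Wc = weak_grad \<Omega> (\<lambda>x. c * u x)"
  have W: "has_weak_gradient \<Omega> u W"
    unfolding W_def by (rule has_weak_gradient_weak_grad[OF G])
  have cW: "has_weak_gradient \<Omega> (\<lambda>x. c * u x) (\<lambda>x. c *\<^sub>R W x)"
    by (rule has_weak_gradient_scale[OF W])
  have Wc: "has_weak_gradient \<Omega> (\<lambda>x. c * u x) Wc"
    unfolding Wc_def by (rule has_weak_gradient_weak_grad[OF cW])
  have loc: "locally_integrable \<Omega> W" "locally_integrable \<Omega> Wc" "locally_integrable \<Omega> u"
    using W Wc by (simp_all add: has_weak_gradient_def)
  have int_u: "integrable (lebesgue_on \<Omega>) (\<lambda>x. u x * \<phi> x)"
    using integrable_test_function_scaleR[OF \<open>open \<Omega>\<close> loc(3) \<phi>] by (simp add: mult.commute)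
  have "(LINT x|lebesgue_on \<Omega>. Wc x \<bullet> grad \<phi> x + lam * (c * u x) * \<phi> x)
      = (LINT x|lebesgue_on \<Omega>. Wc x \<bullet> grad \<phi> x) + (LINT x|lebesgue_on \<Omega>. (lam * c) * (u x * \<phi> x))"
    using integral_inner_grad(1)[OF \<open>open \<Omega>\<close> loc(2) \<phi>] int_u
    by (subst Bochner_Integration.integral_add[symmetric])
       (auto simp: mult.assoc intro!: integrable_mult_right)
  also have "(LINT x|lebesgue_on \<Omega>. Wc x \<bullet> grad \<phi> x) = (LINT x|lebesgue_on \<Omega>. (c *\<^sub>R W x) \<bullet> grad \<phi> x)"
    by (rule integral_weak_gradient_inner_grad_unique[OF \<open>open \<Omega>\<close> Wc cW \<phi>])
  also have "\<dots> + (LINT x|lebesgue_on \<Omega>. (lam * c) * (u x * \<phi> x))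
      = c * ((LINT x|lebesgue_on \<Omega>. W x \<bullet> grad \<phi> x) + (LINT x|lebesgue_on \<Omega>. lam * (u x * \<phi> x)))"
    by (simp add: algebra_simps)
  also have "(LINT x|lebesgue_on \<Omega>. W x \<bullet> grad \<phi> x) + (LINT x|lebesgue_on \<Omega>. lam * (u x * \<phi> x))
      = (LINT x|lebesgue_on \<Omega>. W x \<bullet> grad \<phi> x + lam * u x * \<phi> x)"
    using integral_inner_grad(1)[OF \<open>open \<Omega>\<close> loc(1) \<phi>] int_u
    by (subst Bochner_Integration.integral_add[symmetric])
       (auto simp: mult.assoc intro!: integrable_mult_right)
  also have "\<dots> = (LINT x|lebesgue_on \<Omega>. f x * \<phi> x)"
    using sol \<phi> by (simp add: weak_solution_def W_def)
  also have "c * \<dots> = (LINT x|lebesgue_on \<Omega>. c * f x * \<phi> x)"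
    by (simp add: mult.assoc)
  finally show "(LINT x|lebesgue_on \<Omega>. weak_grad \<Omega> (\<lambda>x. c * u x) x \<bullet> grad \<phi> x + lam * (c * u x) * \<phi> x)
      = (LINT x|lebesgue_on \<Omega>. c * f x * \<phi> x)"
    by (simp add: Wc_def)
qed

section \<open>Invariance of the function spaces under scaling\<close>

lemma Lspace_scale:
  assumes "f \<in> Lspace q \<Omega>"
  shows "(\<lambda>x. c *\<^sub>R f x) \<in> Lspace q \<Omega>"
  using assms by (auto simp: Lspace_def powr_mult)

lemma integral_powr_scale_tendsto_0:
  fixes f :: "nat \<Rightarrow> 'a \<Rightarrow> 'b::{real_normed_vector}" and c :: real
  assumes "(\<lambda>n. LINT x|M. norm (f n x) powr q) \<longlonglongrightarrow> 0"
  shows "(\<lambda>n. LINT x|M. norm (c *\<^sub>R f n x) powr q) \<longlonglongrightarrow> 0"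
  using tendsto_mult_right_zero[OF assms, of "\<bar>c\<bar> powr q"] by (simp add: powr_mult)

lemma integral_power2_scale_tendsto_0:
  fixes f :: "nat \<Rightarrow> 'a \<Rightarrow> 'b::{real_normed_vector}" and c :: real
  assumes "(\<lambda>n. LINT x|M. (norm (f n x))\<^sup>2) \<longlonglongrightarrow> 0"
  shows "(\<lambda>n. LINT x|M. (norm (c *\<^sub>R f n x))\<^sup>2) \<longlonglongrightarrow> 0"
  using tendsto_mult_right_zero[OF assms, of "c\<^sup>2"] by (simp add: power_mult_distrib)

lemma grad_approximation_scale:
  assumes "\<And>n::nat. test_function \<Omega> (\<phi> n)"
    and "(\<lambda>n. LINT x|lebesgue_on \<Omega>. (norm (grad (\<phi> n) x - G x))\<^sup>2) \<longlonglongrightarrow> 0"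
  shows "(\<lambda>n. LINT x|lebesgue_on \<Omega>. (norm (grad (\<lambda>x. c * \<phi> n x) x - c *\<^sub>R G x))\<^sup>2) \<longlonglongrightarrow> 0"
  using integral_power2_scale_tendsto_0[OF assms(2), of c]
    grad_scale[OF test_function_differentiable[OF assms(1)]]
  by (simp add: scaleR_diff_right)

lemma H01_scale:
  assumes "u \<in> H01 \<Omega>"
  shows "(\<lambda>x. c * u x) \<in> H01 \<Omega>"
proof -
  obtain G \<phi> where u: "u \<in> Lspace 2 \<Omega>" and G: "G \<in> Lspace 2 \<Omega>" "has_weak_gradient \<Omega> u G"
    and \<phi>: "\<And>n::nat. test_function \<Omega> (\<phi> n)"
    and lim: "(\<lambda>n. LINT x|lebesgue_on \<Omega>. (\<phi> n x - u x)\<^sup>2) \<longlonglongrightarrow> 0"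
      "(\<lambda>n. LINT x|lebesgue_on \<Omega>. (norm (grad (\<phi> n) x - G x))\<^sup>2) \<longlonglongrightarrow> 0"
    using assms unfolding H01_def by blast
  have "(\<lambda>n. LINT x|lebesgue_on \<Omega>. (c * \<phi> n x - c * u x)\<^sup>2) \<longlonglongrightarrow> 0"
    using integral_power2_scale_tendsto_0[of "lebesgue_on \<Omega>" "\<lambda>n x. \<phi> n x - u x" c] lim(1)
    by (simp add: right_diff_distrib)
  with Lspace_scale[OF u, of c] Lspace_scale[OF G(1), of c] has_weak_gradient_scale[OF G(2), of c]
    test_function_scale[OF \<phi>, of c] grad_approximation_scale[OF \<phi> lim(2), of c]
  show ?thesis
    unfolding H01_def by (auto intro!: bexI[of _ "\<lambda>x. c *\<^sub>R G x"] exI[of _ "\<lambda>n x. c * \<phi> n x"])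
qed

lemma D012_scale:
  fixes u :: "'a::euclidean_space \<Rightarrow> real"
  assumes "u \<in> D012 \<Omega>"
  shows "(\<lambda>x. c * u x) \<in> D012 \<Omega>"
proof -
  let ?q = "crit_exp TYPE('a)"
  obtain G \<phi> where u: "u \<in> Lspace ?q \<Omega>" and G: "G \<in> Lspace 2 \<Omega>" "has_weak_gradient \<Omega> u G"
    and \<phi>: "\<And>n::nat. test_function \<Omega> (\<phi> n)"
    and lim: "(\<lambda>n. LINT x|lebesgue_on \<Omega>. \<bar>\<phi> n x - u x\<bar> powr ?q) \<longlonglongrightarrow> 0"
      "(\<lambda>n. LINT x|lebesgue_on \<Omega>. (norm (grad (\<phi> n) x - G x))\<^sup>2) \<longlonglongrightarrow> 0"
    using assms unfolding D012_def by blast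
  have "(\<lambda>n. LINT x|lebesgue_on \<Omega>. \<bar>c * \<phi> n x - c * u x\<bar> powr ?q) \<longlonglongrightarrow> 0"
    using integral_powr_scale_tendsto_0[of "lebesgue_on \<Omega>" "\<lambda>n x. \<phi> n x - u x" ?q c] lim(1)
    by (simp add: right_diff_distrib)
  with Lspace_scale[OF u, of c] Lspace_scale[OF G(1), of c] has_weak_gradient_scale[OF G(2), of c]
    test_function_scale[OF \<phi>, of c] grad_approximation_scale[OF \<phi> lim(2), of c]
  show ?thesis
    unfolding D012_def by (auto intro!: bexI[of _ "\<lambda>x. c *\<^sub>R G x"] exI[of _ "\<lambda>n x. c * \<phi> n x"])
qed


section \<open>Solutions with proportional components\<close>

theorem theorem1p6:
  fixes \<Omega> :: "(real ^ 'n) set"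
    and H :: "(real ^ 'n \<Rightarrow> real) set"
    and nrm :: "(real ^ 'n \<Rightarrow> real) \<Rightarrow> real"
    and lam p :: real
    and \<beta> :: "real ^ 'l ^ 'l"
  assumes "CARD('n) \<ge> 3" and "CARD('l) \<ge> 2" and "1 < p" and "p < 2"
    and "open \<Omega>" and "\<Omega> \<noteq> {}"
    and "H = H01 \<Omega> \<and> nrm = energy_norm \<Omega> 1 \<or> H = D012 \<Omega> \<and> nrm = energy_norm \<Omega> 0"
    and "well_defined_coercive \<Omega> H nrm lam"
    and "transpose \<beta> = \<beta>"
    and "\<forall>i. \<beta> $ i $ i > 0"
    and "\<forall>i j. i \<noteq> j \<longrightarrow> \<beta> $ i $ j \<ge> 0"
  shows "\<exists>c :: real ^ 'l. (\<forall>i. c $ i > 0) \<and>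
           (\<forall>u. equation_solution \<Omega> H lam p u \<longrightarrow>
                system_solution \<Omega> H lam p \<beta> (\<lambda>i x. c $ i * u x))"
proof -
  have nonneg: "\<beta> $ i $ j \<ge> 0" for i j
    using assms(10,11) by (cases "i = j") (auto simp: less_imp_le)
  obtain c :: "real ^ 'l" where c: "\<And>i. c $ i > 0"
    "\<And>i. (\<Sum>j\<in>UNIV. \<beta> $ i $ j * c $ j powr p) * c $ i powr (p - 2) = 1"
    using coupling_amplitudes[OF assms(3,4,9) nonneg] assms(10) by blast
  have "system_solution \<Omega> H lam p \<beta> (\<lambda>i x. c $ i * u x)" if "equation_solution \<Omega> H lam p u" for u
    unfolding system_solution_def
  proof (intro allI conjI)
    fix i
    have u: "u \<in> H" and sol: "weak_solution \<Omega> lam u (\<lambda>x. \<bar>u x\<bar> powr (2 * p - 2) * u x)"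
      using that by (simp_all add: equation_solution_def)
    show "(\<lambda>x. c $ i * u x) \<in> H"
      using u assms(7) H01_scale D012_scale by blast
    obtain G where "has_weak_gradient \<Omega> u G"
      using u assms(7) unfolding H01_def D012_def by blast
    from weak_solution_scale[OF assms(5) this sol, of "c $ i"]
    show "weak_solution \<Omega> lam (\<lambda>x. c $ i * u x)
        (\<lambda>x. \<Sum>j\<in>UNIV. \<beta> $ i $ j * \<bar>c $ j * u x\<bar> powr p * (\<bar>c $ i * u x\<bar> powr (p - 2) * (c $ i * u x)))"
      by (subst system_nonlinearity_scale[where c = "\<lambda>j. c $ j", OF c])
  qed
  with c(1) show ?thesis by blast
qed

end
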